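(* A formula $\varphi$ of $\mathsf L$ is satisfiable (resp. falsifiable) on an intuitionistic dynamic model if and only if it is satisfiable (resp. falsifiable) on an expanding model.
   Context: Formulas of $\mathsf L$: $p \mid \bot \mid \wedge \mid \vee \mid \to \mid \bigcirc \mid \Diamond \mid \Box \mid \mathsf U \mid \mathsf R$ over a countable set $\mathbb P$ of variables. An intuitionistic dynamic model is $(W,\preccurlyeq,S,V)$ with $W\ne\varnothing$, $\preccurlyeq$ a partial order, $S\colon W\to W$ with $w\preccurlyeq v\Rightarrow S(w)\preccurlyeq S(v)$, and $V\colon W\to\mathcal P(\mathbb P)$ with $w\preccurlyeq v\Rightarrow V(w)\subseteq V(v)$. Satisfaction: atoms by $V$; $\bot$ false; $\wedge,\vee$ classical; $w\models\bigcirc\varphi$ iff $S(w)\models\varphi$; $w\models\varphi\to\psi$ iff all $v\succcurlyeq w$ with $v\models\varphi$ have $v\models\psi$; $\Diamond\varphi$: some $S^k(w)\models\varphi$; $\Box\varphi$: all $S^k(w)\models\varphi$ ($k\ge 0$); $\varphi\,\mathsf U\,\psi$: some $k$ with $S^k(w)\models\psi$ and $S^i(w)\models\varphi$ for all $i<k$; $\varphi\,\mathsf R\,\psi$: for all $k$, $S^k(w)\models\psi$ or some $i<k$ has $S^i(w)\models\varphi$. A poset $(X,\le)$ is a tree if there is a relation $\uparrow$ on $X$ with $\le$ equal to the reflexive transitive closure of $\uparrow$, and an element $r$ (root) such that for every $x\in X$ there is a unique $\uparrow$-path from $r$ to $x$. A model is stratified if there is a partition $\{W_n\}_{n<\omega}$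 of $W$ such that each $W_n$ is closed under $\preccurlyeq$, each $(W_n,\preccurlyeq\restriction W_n)$ is a tree, and $w\in W_n$ implies $S(w)\in W_{n+1}$. A stratified model is expanding if moreover $S(w)\preccurlyeq S(v)$ implies $w\preccurlyeq v$. *)

theory Defs
  imports Main "HOL-Library.Countable" "HOL-Library.FuncSet" "HOL-Library.Disjoint_Sets"
begin

datatype 'p fm =
    Var 'p
  | Falsum
  | Conj "'p fm" "'p fm"
  | Disj "'p fm" "'p fm"
  | Imp "'p fm" "'p fm"
  | Next "'p fm"
  | Eventually "'p fm"
  | Henceforth "'p fm"
  | Until "'p fm" "'p fm"
  | Release "'p fm" "'p fm"

text \<open>
  The set of worlds is an explicit carrier in the type \<^typ>\<open>'w\<close>; \<open>(w, v) \<in> ord M\<close> means that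
  \<open>v\<close> lies above \<open>w\<close>.  A stratified model (below) has infinitely many worlds, so a statement
  asserting that one exists needs \<^typ>\<open>'w\<close> to be infinite; carriers of other models may be finite.
\<close>

record ('w, 'p) dynamic_structure =
  worlds :: "'w set"
  ord :: "'w rel"
  step :: "'w \<Rightarrow> 'w"
  val :: "'w \<Rightarrow> 'p set"

definition dynamic_model :: "('w, 'p) dynamic_structure \<Rightarrow> bool" where
  "dynamic_model M \<longleftrightarrow>
     worlds M \<noteq> {} \<and>
     partial_order_on (worlds M) (ord M) \<and>
     step M \<in> worlds M \<rightarrow> worlds M \<and>
     (\<forall>(w, v) \<in> ord M. (step M w, step M v) \<in> ord M) \<and>
     (\<forall>(w, v) \<in> ord M. val M w \<subseteq> val M v)"

primrec sat :: "('w, 'p) dynamic_structure \<Rightarrow> 'w \<Rightarrow> 'p fm \<Rightarrow> bool" where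
  "sat M w (Var p) \<longleftrightarrow> p \<in> val M w"
| "sat M w Falsum \<longleftrightarrow> False"
| "sat M w (Conj \<phi> \<psi>) \<longleftrightarrow> sat M w \<phi> \<and> sat M w \<psi>"
| "sat M w (Disj \<phi> \<psi>) \<longleftrightarrow> sat M w \<phi> \<or> sat M w \<psi>"
| "sat M w (Imp \<phi> \<psi>) \<longleftrightarrow> (\<forall>v\<in>worlds M. (w, v) \<in> ord M \<longrightarrow> sat M v \<phi> \<longrightarrow> sat M v \<psi>)"
| "sat M w (Next \<phi>) \<longleftrightarrow> sat M (step M w) \<phi>"
| "sat M w (Eventually \<phi>) \<longleftrightarrow> (\<exists>k. sat M ((step M ^^ k) w) \<phi>)"
| "sat M w (Henceforth \<phi>) \<longleftrightarrow> (\<forall>k. sat M ((step M ^^ k) w) \<phi>)"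
| "sat M w (Until \<phi> \<psi>) \<longleftrightarrow>
     (\<exists>k. sat M ((step M ^^ k) w) \<psi> \<and> (\<forall>i<k. sat M ((step M ^^ i) w) \<phi>))"
| "sat M w (Release \<phi> \<psi>) \<longleftrightarrow>
     (\<forall>k. sat M ((step M ^^ k) w) \<psi> \<or> (\<exists>i<k. sat M ((step M ^^ i) w) \<phi>))"

definition satisfiable_on :: "('w, 'p) dynamic_structure \<Rightarrow> 'p fm \<Rightarrow> bool" where
  "satisfiable_on M \<phi> \<longleftrightarrow> (\<exists>w\<in>worlds M. sat M w \<phi>)"

definition falsifiable_on :: "('w, 'p) dynamic_structure \<Rightarrow> 'p fm \<Rightarrow> bool" where
  "falsifiable_on M \<phi> \<longleftrightarrow> (\<exists>w\<in>worlds M. \<not> sat M w \<phi>)"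

definition path_between :: "'a rel \<Rightarrow> 'a \<Rightarrow> 'a \<Rightarrow> 'a list \<Rightarrow> bool" where
  "path_between E r x xs \<longleftrightarrow>
     xs \<noteq> [] \<and> hd xs = r \<and> last xs = x \<and> successively (\<lambda>a b. (a, b) \<in> E) xs"

text \<open>
  \<^term>\<open>E\<^sup>*\<close> is reflexive on the whole type, so it is cut down to \<open>X\<close>; as \<open>E\<close> is a relation
  on \<open>X\<close>, this is the reflexive transitive closure of \<open>E\<close> on \<open>X\<close>.
\<close>

definition is_tree :: "'a set \<Rightarrow> 'a rel \<Rightarrow> bool" where
  "is_tree X le \<longleftrightarrow>
     partial_order_on X le \<and>
     (\<exists>E. E \<subseteq> X \<times> X \<and> le = Restr (E\<^sup>*) X \<and>
          (\<exists>r\<in>X. \<forall>x\<in>X. \<exists>!xs. path_between E r x xs))"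

text \<open>
  Blocks of a partition are nonempty.  Closure of every block under going upwards entails closure
  under going downwards, since the blocks partition the set of worlds.
\<close>

definition stratified :: "('w, 'p) dynamic_structure \<Rightarrow> bool" where
  "stratified M \<longleftrightarrow>
     dynamic_model M \<and>
     (\<exists>P :: nat \<Rightarrow> 'w set.
        (\<Union>n. P n) = worlds M \<and> disjoint_family P \<and> (\<forall>n. P n \<noteq> {}) \<and>
        (\<forall>n. \<forall>(w, v) \<in> ord M. w \<in> P n \<longrightarrow> v \<in> P n) \<and>
        (\<forall>n. is_tree (P n) (Restr (ord M) (P n))) \<and>
        (\<forall>n. \<forall>w \<in> P n. step M w \<in> P (Suc n)))"

definition expanding :: "('w, 'p) dynamic_structure \<Rightarrow> bool" where
  "expanding M \<longleftrightarrow>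
     stratified M \<and>
     (\<forall>w\<in>worlds M. \<forall>v\<in>worlds M. (step M w, step M v) \<in> ord M \<longrightarrow> (w, v) \<in> ord M)"

end

theory Submission
  imports Defs "HOL-Library.Sublist"
begin

text \<open>
  Fix a world \<open>w0\<close> of the given model.  The \<open>n\<close>-th stratum of its expanding unravelling consists
  of the finite ascending chains of worlds that start at \<open>S\<^sup>n w0\<close>, ordered by extension, and a chain
  stands for its top element.  An element \<open>x\<close> added to the chain in stratum \<open>t\<close> is recorded as the
  pair \<open>(x, t)\<close>, and in stratum \<open>n \<ge> t\<close> this pair denotes \<open>S\<^sup>n\<^sup>-\<^sup>t x\<close>.  Hence the step function can leave the
  list of pairs untouched and only increment \<open>n\<close>, so it reflects the order trivially; that the
  denoted worlds remain a chain is the monotonicity of \<open>S\<close>.  Sending a chain to its top element is a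
  p-morphism commuting with the step functions, so it preserves and reflects truth.
\<close>

section \<open>Coding indexed lists by elements of an infinite type\<close>

lemma infinite_inj_list:
  assumes "infinite (UNIV :: 'a set)"
  obtains f :: "'a list \<Rightarrow> 'a" where "inj f"
proof -
  obtain g :: "'a \<times> 'a \<Rightarrow> 'a" where g: "inj g"
    using ordIso_imp_ordLeq[OF card_of_Times_same_infinite[OF assms]]
    unfolding card_of_ordLeq[symmetric] by auto
  obtain a b :: 'a where ab: "a \<noteq> b"
    using ex_new_if_finite[OF assms, of "{undefined}"] by auto
  \<comment> \<open>The distinct tags \<open>a\<close> and \<open>b\<close> in the first component
    separate \<open>[]\<close> from nonempty lists; the second component holds the data of the
    list.\<close>
  define f where "f = rec_list (g (a, a)) (\<lambda>x _ y. g (b, g (x, y)))"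
  have f: "f [] = g (a, a)" "f (x # xs) = g (b, g (x, f xs))" for x xs
    by (simp_all add: f_def)
  have "xs = ys" if "f xs = f ys" for xs ys
    using that
  proof (induction xs arbitrary: ys)
    case Nil
    then show ?case
      using ab by (cases ys) (auto simp: f inj_eq[OF g])
  next
    case (Cons x xs)
    then show ?case
      using ab by (cases ys) (auto simp: f inj_eq[OF g])
  qed
  then show ?thesis
    by (intro that) (rule injI)
qed

text \<open>The expanding model is sought over the same type of worlds as the given model, so the
  indexed lists that form its worlds have to be coded inside that type.\<close>

lemma infinite_inj_indexed_list:
  assumes "infinite (UNIV :: 'a set)"
  obtains f :: "nat \<times> ('a \<times> nat) list \<Rightarrow> 'a" where "inj f"
proof -
  obtain g :: "'a list \<Rightarrow> 'a" where g: "inj g"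
    using infinite_inj_list[OF assms] .
  obtain h :: "nat \<Rightarrow> 'a" where h: "inj h"
    using assms unfolding infinite_iff_countable_subset by auto
  define k where "k = (\<lambda>(x, n). g [x, h n])"
  have "inj k"
    by (intro injI) (auto simp: k_def inj_eq[OF g] inj_eq[OF h])
  then have "inj (\<lambda>(n, xs). g (h n # map k xs))"
    by (intro injI) (auto simp: inj_eq[OF g] inj_eq[OF h] dest: map_injective)
  then show ?thesis
    by (rule that)
qed

section \<open>Trees of lists under the suffix order\<close>

text \<open>An edge adds one element at the head. The only predecessor of a nonempty list is its
  tail, so the only path from \<open>[]\<close> to \<open>l\<close> runs through the suffixes of
  \<open>l\<close> by increasing length.\<close>

lemma is_tree_suffix:
  assumes inj: "inj c" and Nil: "[] \<in> Y" and suf: "\<And>x xs. x # xs \<in> Y \<Longrightarrow> xs \<in> Y"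
  shows "is_tree (c ` Y) {(c k, c l) | k l. k \<in> Y \<and> l \<in> Y \<and> suffix k l}"
    (is "is_tree ?X ?le")
proof -
  define E where "E = {(c xs, c (x # xs)) | x xs. x # xs \<in> Y}"
  have E_iff: "(c k, c l) \<in> E \<longleftrightarrow> l \<in> Y \<and> (\<exists>x. l = x # k)" for k l
    by (auto simp: E_def inj_eq[OF inj])
  have E_sub: "E \<subseteq> ?X \<times> ?X"
    using suf by (auto simp: E_def)
  have star: "(c k, c l) \<in> E\<^sup>*" if "l \<in> Y" "suffix k l" for k l
    using that
  proof (induction l)
    case (Cons x l)
    then have "(c l, c (x # l)) \<in> E" "suffix k l \<Longrightarrow> (c k, c l) \<in> E\<^sup>*"
      by (auto simp: E_iff dest: suf)
    with Cons.prems show ?case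
      by (auto simp: suffix_Cons intro: rtrancl_into_rtrancl)
  qed auto
  have unstar: "suffix k l" if "(a, b) \<in> E\<^sup>*" "a = c k" "b = c l" for a b k l
    using that
  proof (induction arbitrary: l rule: rtrancl_induct)
    case (step y z)
    then show ?case
      by (auto simp: E_def inj_eq[OF inj] intro: suffix_ConsI)
  qed (auto simp: inj_eq[OF inj])
  have po: "partial_order_on ?X ?le"
    unfolding partial_order_on_def preorder_on_def refl_on_def trans_def antisym_def
    by (auto simp: inj_eq[OF inj] intro: suffix_order.antisym)
  have le: "?le = Restr (E\<^sup>*) ?X"
    using star unstar by fastforce
  have path: "path_between E (c []) (c l) (map c (suffixes l))" if "l \<in> Y" for l
    using that
  proof (induction l)
    case (Cons x l)
    then have "path_between E (c []) (c l) (map c (suffixes l))"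
      by (auto dest: suf)
    with Cons.prems show ?case
      by (auto simp: path_between_def successively_append_iff E_iff)
  qed (simp add: path_between_def)
  have uniq: "xs = map c (suffixes l)" if "path_between E (c []) (c l) xs" for l xs
    using that
  proof (induction l arbitrary: xs)
    case Nil
    then obtain ys where ys: "xs = ys @ [c []]"
      unfolding path_between_def by (metis append_butlast_last_id)
    \<comment> \<open>No edge enters \<open>c []\<close>, so nothing can precede it on a
      path.\<close>
    have "ys = []"
      using Nil ys by (auto simp: path_between_def successively_append_iff E_def inj_eq[OF inj])
    with ys show ?case by simp
  next
    case (Cons x l)
    then obtain ys where ys: "xs = ys @ [c (x # l)]"
      unfolding path_between_def by (metis append_butlast_last_id)
    have "ys \<noteq> []"
      using Cons.prems ys by (auto simp: path_between_def inj_eq[OF inj])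
    \<comment> \<open>The only edge into \<open>c (x # l)\<close> starts at \<open>c l\<close>, so
      dropping the last node leaves a path to \<open>c l\<close>.\<close>
    with Cons.prems ys have "path_between E (c []) (c l) ys"
      by (auto simp: path_between_def successively_append_iff E_def inj_eq[OF inj])
    with Cons.IH ys show ?case by auto
  qed
  have "\<forall>x\<in>?X. \<exists>!xs. path_between E (c []) x xs"
    using path uniq by blast
  then have "\<exists>r\<in>?X. \<forall>x\<in>?X. \<exists>!xs. path_between E r x xs"
    using Nil by (intro bexI[of _ "c []"] imageI)
  then show ?thesis
    unfolding is_tree_def by (intro conjI po exI[of _ E] E_sub le)
qed

section \<open>The unravelling of a model from a world\<close>

locale unravelling =
  fixes M :: "('w, 'p) dynamic_structure" and w0 :: 'w
    and enc :: "nat \<times> ('w \<times> nat) list \<Rightarrow> 'v"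
  assumes model: "dynamic_model M" and w0: "w0 \<in> worlds M" and inj_enc: "inj enc"
begin

fun top_of :: "nat \<Rightarrow> ('w \<times> nat) list \<Rightarrow> 'w" where
  "top_of n [] = (step M ^^ n) w0"
| "top_of n ((x, t) # l) = (step M ^^ (n - t)) x"

text \<open>The bound \<open>t \<le> n\<close> keeps the subtraction \<open>n - t\<close> from being
  truncated. The newest element is the head, so extension of chains is the suffix order; the
  starting point stays implicit as the empty list.\<close>

fun chain :: "nat \<Rightarrow> ('w \<times> nat) list \<Rightarrow> bool" where
  "chain n [] \<longleftrightarrow> True"
| "chain n ((x, t) # l) \<longleftrightarrow>
     chain n l \<and> x \<in> worlds M \<and> t \<le> n \<and> (top_of n l, top_of n ((x, t) # l)) \<in> ord M"

text \<open>One list of pairs recurs in all later strata; the index inside the code keeps the strata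
  disjoint.\<close>

definition stratum :: "nat \<Rightarrow> 'v set" where
  "stratum n = {enc (n, l) | l. chain n l}"

definition U :: "('v, 'p) dynamic_structure" where
  "U = \<lparr>worlds = (\<Union>n. stratum n),
        ord = {(enc (n, k), enc (n, l)) | n k l. chain n k \<and> chain n l \<and> suffix k l},
        step = (\<lambda>v. case inv enc v of (n, l) \<Rightarrow> enc (Suc n, l)),
        val = (\<lambda>v. case inv enc v of (n, l) \<Rightarrow> val M (top_of n l))\<rparr>"

lemma enc_eq [simp]: "enc a = enc b \<longleftrightarrow> a = b"
  using inj_enc by (rule inj_eq)

lemma step_U [simp]: "step U (enc (n, l)) = enc (Suc n, l)"
  and val_U [simp]: "val U (enc (n, l)) = val M (top_of n l)"
  by (simp_all add: U_def inj_enc)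

lemma step_pow_U [simp]: "(step U ^^ k) (enc (n, l)) = enc (n + k, l)"
  by (induction k) auto

lemma worlds_U: "v \<in> worlds U \<longleftrightarrow> (\<exists>n l. v = enc (n, l) \<and> chain n l)"
  by (auto simp: U_def stratum_def)

lemma ord_U:
  "(v, v') \<in> ord U \<longleftrightarrow>
     (\<exists>n k l. v = enc (n, k) \<and> v' = enc (n, l) \<and> chain n k \<and> chain n l \<and> suffix k l)"
  by (auto simp: U_def)

lemma
  shows step_worlds: "x \<in> worlds M \<Longrightarrow> step M x \<in> worlds M"
    and step_mono: "(x, y) \<in> ord M \<Longrightarrow> (step M x, step M y) \<in> ord M"
    and val_mono: "(x, y) \<in> ord M \<Longrightarrow> val M x \<subseteq> val M y"
    and ord_refl: "x \<in> worlds M \<Longrightarrow> (x, x) \<in> ord M"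
    and ord_trans: "(x, y) \<in> ord M \<Longrightarrow> (y, z) \<in> ord M \<Longrightarrow> (x, z) \<in> ord M"
  using model
  unfolding dynamic_model_def partial_order_on_def preorder_on_def refl_on_def trans_def
  by blast+

lemma step_pow_worlds: "x \<in> worlds M \<Longrightarrow> (step M ^^ n) x \<in> worlds M"
  by (induction n) (auto intro: step_worlds)

lemma top_of_worlds: "chain n l \<Longrightarrow> top_of n l \<in> worlds M"
  by (cases "(n, l)" rule: top_of.cases) (auto intro: step_pow_worlds w0)

lemma top_of_Suc: "chain n l \<Longrightarrow> top_of (Suc n) l = step M (top_of n l)"
  by (cases "(n, l)" rule: top_of.cases) (auto simp: Suc_diff_le)

lemma chain_Suc: "chain n l \<Longrightarrow> chain (Suc n) l"
proof (induction l)
  case (Cons a l)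
  obtain x t where a: "a = (x, t)" by fastforce
  have "(top_of (Suc n) l, top_of (Suc n) (a # l)) \<in> ord M"
    using Cons.prems step_mono top_of_Suc[of n l] top_of_Suc[of n "a # l"] a by auto
  then show ?case
    using Cons a by simp
qed simp

lemma chain_add: "chain n l \<Longrightarrow> chain (n + k) l"
  by (induction k) (auto intro: chain_Suc)

lemma top_of_add: "chain n l \<Longrightarrow> top_of (n + k) l = (step M ^^ k) (top_of n l)"
  by (induction k) (auto simp: top_of_Suc chain_add)

lemma top_of_mono: "chain n l \<Longrightarrow> suffix k l \<Longrightarrow> (top_of n k, top_of n l) \<in> ord M"
proof (induction l)
  case Nil
  then show ?case by (auto intro: ord_refl step_pow_worlds w0)
next
  case (Cons a l)
  obtain x t where a: "a = (x, t)" by fastforce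
  from Cons.prems consider "k = a # l" | "suffix k l"
    by (auto simp: suffix_Cons)
  then show ?case
  proof cases
    case 1
    with Cons.prems show ?thesis by (auto intro: ord_refl top_of_worlds)
  next
    case 2
    with Cons a show ?thesis by (auto intro: ord_trans)
  qed
qed

text \<open>For implication, truth passes from \<open>M\<close> to \<open>U\<close> because tops
  grow with the chain, and from \<open>U\<close> to \<open>M\<close> because every world above the
  top is the top of a longer chain.\<close>

lemma sat_U: "chain n l \<Longrightarrow> sat U (enc (n, l)) \<psi> \<longleftrightarrow> sat M (top_of n l) \<psi>"
proof (induction \<psi> arbitrary: n l)
  case (Imp \<phi> \<psi>)
  show ?case
  proof
    assume L: "sat U (enc (n, l)) (Imp \<phi> \<psi>)"
    show "sat M (top_of n l) (Imp \<phi> \<psi>)"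
      unfolding sat.simps
    proof (intro ballI impI)
      fix v assume v: "v \<in> worlds M" "(top_of n l, v) \<in> ord M" "sat M v \<phi>"
      \<comment> \<open>With time stamp \<open>n\<close> the delay is \<open>n - n = 0\<close>, so
        the new head denotes \<open>v\<close> itself.\<close>
      have c: "chain n ((v, n) # l)" "top_of n ((v, n) # l) = v"
        using v Imp.prems by auto
      moreover have "(enc (n, l), enc (n, (v, n) # l)) \<in> ord U"
        using c Imp.prems by (auto simp: ord_U suffix_Cons)
      moreover have "enc (n, (v, n) # l) \<in> worlds U"
        using c by (auto simp: worlds_U)
      ultimately show "sat M v \<psi>"
        using L v Imp.IH by (metis sat.simps(5))
    qed
  next
    assume "sat M (top_of n l) (Imp \<phi> \<psi>)"
    then show "sat U (enc (n, l)) (Imp \<phi> \<psi>)"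
      using Imp.IH by (auto simp: ord_U top_of_mono top_of_worlds)
  qed
qed (simp_all add: top_of_Suc chain_Suc top_of_add chain_add)

section \<open>The unravelling is an expanding model\<close>

lemma dynamic_model_U: "dynamic_model U"
proof -
  have "enc (0, []) \<in> worlds U"
    by (auto simp: worlds_U)
  moreover have "partial_order_on (worlds U) (ord U)"
    unfolding partial_order_on_def preorder_on_def refl_on_def trans_def antisym_def
    by (auto simp: worlds_U ord_U intro: suffix_order.antisym)
  moreover have "step U \<in> worlds U \<rightarrow> worlds U"
    by (auto simp: worlds_U chain_Suc)
  moreover have "\<forall>(w, v) \<in> ord U. (step U w, step U v) \<in> ord U"
    by (auto simp: ord_U chain_Suc)
  moreover have "\<forall>(w, v) \<in> ord U. val U w \<subseteq> val U v"
    using val_mono top_of_mono by (fastforce simp: ord_U)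
  ultimately show ?thesis
    unfolding dynamic_model_def by blast
qed

lemma stratified_U: "stratified U"
proof -
  have tree: "is_tree (stratum n) (Restr (ord U) (stratum n))" for n
  proof -
    have "is_tree ((\<lambda>l. enc (n, l)) ` {l. chain n l})
        {(enc (n, k), enc (n, l)) | k l. k \<in> {l. chain n l} \<and> l \<in> {l. chain n l} \<and> suffix k l}"
      by (rule is_tree_suffix) (auto simp: inj_def)
    moreover have "(\<lambda>l. enc (n, l)) ` {l. chain n l} = stratum n"
      by (auto simp: stratum_def)
    moreover have "{(enc (n, k), enc (n, l)) | k l.
          k \<in> {l. chain n l} \<and> l \<in> {l. chain n l} \<and> suffix k l} = Restr (ord U) (stratum n)"
      by (auto simp: stratum_def ord_U)
    ultimately show ?thesis by simp
  qed
  have "(\<Union>n. stratum n) = worlds U"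
    by (simp add: U_def)
  moreover have "disjoint_family stratum"
    by (auto simp: disjoint_family_on_def stratum_def)
  moreover have "stratum n \<noteq> {}" for n
    using chain.simps(1)[of n] unfolding stratum_def by blast
  moreover have "\<forall>(w, v) \<in> ord U. w \<in> stratum n \<longrightarrow> v \<in> stratum n" for n
    by (auto simp: stratum_def ord_U)
  moreover have "\<forall>w \<in> stratum n. step U w \<in> stratum (Suc n)" for n
    by (auto simp: stratum_def chain_Suc)
  ultimately show ?thesis
    unfolding stratified_def using dynamic_model_U tree by blast
qed

text \<open>A step changes only the index, so the suffix relation is reflected. Comparability after
  the step gives chains only at \<open>Suc n\<close>; that they are chains at \<open>n\<close> comes
  from both points being worlds.\<close>

lemma expanding_U: "expanding U"
  unfolding expanding_def using stratified_U by (auto simp: worlds_U ord_U)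

lemma root_U: "enc (0, []) \<in> worlds U" "sat U (enc (0, [])) \<psi> \<longleftrightarrow> sat M w0 \<psi>"
  using sat_U[of 0 "[]"] by (auto simp: worlds_U)

end

theorem theorem3p8:
  fixes \<phi> :: "'p::countable fm"
  assumes "infinite (UNIV :: 'w set)"
  shows "((\<exists>M :: ('w, 'p) dynamic_structure. dynamic_model M \<and> satisfiable_on M \<phi>) \<longleftrightarrow>
          (\<exists>M :: ('w, 'p) dynamic_structure. expanding M \<and> satisfiable_on M \<phi>)) \<and>
         ((\<exists>M :: ('w, 'p) dynamic_structure. dynamic_model M \<and> falsifiable_on M \<phi>) \<longleftrightarrow>
          (\<exists>M :: ('w, 'p) dynamic_structure. expanding M \<and> falsifiable_on M \<phi>))"
proof -
  obtain enc :: "nat \<times> ('w \<times> nat) list \<Rightarrow> 'w" where enc: "inj enc"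
    using infinite_inj_indexed_list[OF assms] .
  \<comment> \<open>An equivalence at a single world serves satisfiability and falsifiability
    alike.\<close>
  have unravel: "\<exists>N :: ('w, 'p) dynamic_structure. expanding N \<and>
      (\<exists>v\<in>worlds N. sat N v \<phi> \<longleftrightarrow> sat M w \<phi>)"
    if "dynamic_model M" "w \<in> worlds M" for M :: "('w, 'p) dynamic_structure" and w
  proof -
    interpret unravelling M w enc
      using that enc by unfold_locales
    show ?thesis
      using expanding_U root_U by blast
  qed
  have "dynamic_model M" if "expanding M" for M :: "('w, 'p) dynamic_structure"
    using that by (simp add: expanding_def stratified_def)
  then show ?thesis
    unfolding satisfiable_on_def falsifiable_on_def using unravel by blast
qed

end
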